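(* For a positive integer $m$, let $S(2,m)$ denote the number of nonstandard solutions of a $2$-dice game with dice-size $m$. Then, for every prime $p$ and every positive integer $k$, the number $S(2,p^{k})$ depends only on $k$ (that is, $S(2,p^k)=S(2,q^k)$ for all primes $p,q$ and all integers $k\ge 1$). Moreover, for every prime $p$ and every integer $k\ge 4$, \[\frac{3^{k}+(-1)^{k}-2}{2k} < S(2,p^{k}) < \frac{3^{k}+(-1)^{k}-2}{4}.\]
   Context: A dice of size $m$ is a labeling by $m$ positive integers, counted with repetition; the order of the labels is irrelevant, so a dice of size $m$ is a multiset of $m$ positive integers. The standard dice of size $m$ is the one with labels $1,2,\dots,m$. A $2$-dice game with dice-size $m$ consists of two dice of size $m$, and the standard such game consists of two standard dice. One considers $2$-dice games $(a_1,\dots,a_m)$, $(b_1,\dots,b_m)$ whose sums have the same distribution as in the standard game, i.e. for every integer $s$ the number of pairs $(i,j)\in\{1,\dots,m\}^2$ with $a_i+b_j=s$ equals the number of pairs $(i,j)\in\{1,\dots,m\}^2$ with $i+j=s$. A solution of a $2$-dice game with dice-size $m$ is any labeling (multiset of $m$ positive integers) that appears on one of the two dice of such a game; equivalently, a multiset $A$ of $m$ positive integers for which there is a multiset $B$ of $m$ positive integers such that the pair $(A,B)$ has the same sum distribution as the standard game. A solution is nonstandard if it is not the standard labeling $\{1,2,\dots,m\}$. Thus $S(2,m)$ is the number of such multisets $A\neq\{1,\dots,m\}$. *)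

theory Defs
  imports "HOL-Library.Multiset" "HOL-Computational_Algebra.Primes" Complex_Main
begin

definition is_dice :: "nat \<Rightarrow> nat multiset \<Rightarrow> bool" where
  "is_dice m A \<longleftrightarrow> size A = m \<and> (\<forall>a \<in># A. a > 0)"

definition standard_dice :: "nat \<Rightarrow> nat multiset" where
  "standard_dice m = mset_set {1..m}"

text \<open>The multiset of all sums \<open>a_i + b_j\<close>; the multiplicity of \<open>s\<close> is the number of
  index pairs \<open>(i, j)\<close> with \<open>a_i + b_j = s\<close>.\<close>

definition dice_sums :: "nat multiset \<Rightarrow> nat multiset \<Rightarrow> nat multiset" where
  "dice_sums A B = (\<Sum>a\<in>#A. {# a + b. b \<in># B #})"

text \<open>Labels are natural numbers, so integers \<open>s < 0\<close> are never sums and need not be considered.\<close>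

definition standard_sums :: "nat \<Rightarrow> nat multiset \<Rightarrow> nat multiset \<Rightarrow> bool" where
  "standard_sums m A B \<longleftrightarrow>
     (\<forall>s. count (dice_sums A B) s = card {(i, j) \<in> {1..m} \<times> {1..m}. i + j = s})"

definition is_solution :: "nat \<Rightarrow> nat multiset \<Rightarrow> bool" where
  "is_solution m A \<longleftrightarrow> is_dice m A \<and> (\<exists>B. is_dice m B \<and> standard_sums m A B)"

definition nonstandard_solutions :: "nat \<Rightarrow> nat multiset set" where
  "nonstandard_solutions m = {A. is_solution m A \<and> A \<noteq> standard_dice m}"

definition S2 :: "nat \<Rightarrow> nat" where
  "S2 m = card (nonstandard_solutions m)"

text \<open>The set being counted is finite, so \<^const>\<open>card\<close> is the actual number of solutions.\<close>

lemma solution_label_le: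
  assumes "is_solution m A" and a: "a \<in># A"
  shows "a \<le> 2 * m"
proof -
  from assms obtain B where A: "is_dice m A" and B: "is_dice m B" and AB: "standard_sums m A B"
    by (auto simp: is_solution_def)
  have "A \<noteq> {#}" using a by auto
  hence "B \<noteq> {#}" using A B by (auto simp: is_dice_def)
  then obtain b where b: "b \<in># B" by blast
  have "a + b \<in># dice_sums A B" using a b by (auto simp: dice_sums_def)
  hence "count (dice_sums A B) (a + b) \<noteq> 0" by simp
  hence "card {(i, j) \<in> {1..m} \<times> {1..m}. i + j = a + b} \<noteq> 0"
    using AB unfolding standard_sums_def by metis
  hence "{(i, j) \<in> {1..m} \<times> {1..m}. i + j = a + b} \<noteq> {}" by (metis card.empty)
  thus ?thesis by auto
qed

lemma finite_nonstandard_solutions: "finite (nonstandard_solutions m)"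
proof (rule finite_subset)
  show "nonstandard_solutions m \<subseteq> mset ` {xs. set xs \<subseteq> {..2 * m} \<and> length xs = m}"
  proof
    fix A assume "A \<in> nonstandard_solutions m"
    hence sol: "is_solution m A" by (simp add: nonstandard_solutions_def)
    obtain xs where xs: "mset xs = A" using ex_mset by blast
    have "set xs \<subseteq> {..2 * m}" using solution_label_le[OF sol] xs by auto
    moreover have "length xs = m" using sol xs by (auto simp: is_solution_def is_dice_def)
    ultimately show "A \<in> mset ` {xs. set xs \<subseteq> {..2 * m} \<and> length xs = m}" using xs by blast
  qed
  show "finite (mset ` {xs. set xs \<subseteq> {..2 * m} \<and> length xs = m})"
    by (intro finite_imageI finite_lists_length_eq) simp
qed

end

theory Submission
  imports Defs "HOL-Computational_Algebra.Polynomial_Factorial" "HOL-Library.FuncSet"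
begin

text \<open>
  Encode a dice \<open>A\<close> by the polynomial \<open>\<Sum>a\<in>A. X^a\<close>, so that the sums of two dice correspond to the
  product of their polynomials. The standard dice of size \<open>p^k\<close> has polynomial
  \<open>X \<Phi>\<^sub>1 \<dots> \<Phi>\<^sub>k\<close>, where \<open>\<Phi>\<^sub>i\<close> is the \<open>p^i\<close>-th cyclotomic polynomial: it is irreducible by
  Eisenstein's criterion, has nonnegative coefficients and takes the value \<open>p\<close> at \<open>1\<close>. By unique
  factorization the solutions are exactly the products \<open>X \<Phi>\<^sub>1^e\<^sub>1 \<dots> \<Phi>\<^sub>k^e\<^sub>k\<close> with
  \<open>e\<^sub>i \<in> {0, 1, 2}\<close> and \<open>e\<^sub>1 + \<dots> + e\<^sub>k = k\<close>, so their number is the central trinomial coefficient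
  \<open>T\<^sub>k\<close>, the coefficient of \<open>x^0\<close> in \<open>(x^-1 + 1 + x)^k\<close>. The lower bound holds because \<open>T\<^sub>k\<close> is
  the largest of the \<open>2k + 1\<close> coefficients and the two outer ones are \<open>1\<close>; the upper bound because the
  coefficients of all \<open>x^j\<close> with \<open>4 | j\<close> sum to \<open>(3^k + (-1)^k + 2) / 4\<close>.
\<close>

subsection \<open>Irreducibility of cyclotomic polynomials of prime power order\<close>

text \<open>In a factorization \<open>p\<close> divides exactly one constant term. The lowest
  coefficient of that factor not divisible by \<open>p\<close> forces its degree up to
  \<open>degree F\<close>. The other factor is then a constant dividing the leading coefficient 1,
  hence a unit.\<close>

lemma irreducible_eisenstein:
  fixes F :: "'a :: idom_divide poly" and p :: 'a
  assumes p: "prime_elem p" and monic: "lead_coeff F = 1" and deg: "degree F > 0"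
    and dvd: "\<And>i. i < degree F \<Longrightarrow> p dvd coeff F i" and nsq: "\<not> p ^ 2 dvd coeff F 0"
  shows "irreducible F"
proof (rule irreducibleI)
  show "F \<noteq> 0" using deg by auto
  show "\<not> is_unit F" using deg by (auto simp: is_unit_poly_iff)
next
  have *: "is_unit g" if F: "F = f * g" and pf: "p dvd coeff f 0" for f g
  proof -
    have nz: "f \<noteq> 0" "g \<noteq> 0" using F deg by auto
    have lead: "lead_coeff f * lead_coeff g = 1"
      using monic unfolding F by (simp add: lead_coeff_mult)
    have pg: "\<not> p dvd coeff g 0"
      using pf nsq unfolding F by (auto simp: coeff_mult_0 power2_eq_square intro: mult_dvd_mono)
    have "\<not> p dvd lead_coeff f"
      using p lead by (metis dvd_triv_left dvd_trans prime_elem_not_unit)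
    define i where "i = (LEAST i. \<not> p dvd coeff f i)"
    have i: "\<not> p dvd coeff f i" and le: "i \<le> degree f"
      unfolding i_def using \<open>\<not> p dvd lead_coeff f\<close>
      by (rule LeastI, rule Least_le)
    have less: "p dvd coeff f j" if "j < i" for j
      using not_less_Least that unfolding i_def by blast
    \<comment> \<open>Modulo \<open>p\<close> only the last term of the convolution survives, by
      minimality of \<open>i\<close>.\<close>
    have "coeff F i = (\<Sum>j<i. coeff f j * coeff g (i - j)) + coeff f i * coeff g 0"
      unfolding F by (simp add: coeff_mult lessThan_Suc_atMost[symmetric])
    moreover have "p dvd (\<Sum>j<i. coeff f j * coeff g (i - j))"
      by (rule dvd_sum) (use less in auto)
    moreover have "\<not> p dvd coeff f i * coeff g 0"
      using i pg p prime_elem_dvd_mult_iff by blast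
    ultimately have "\<not> p dvd coeff F i" by (metis dvd_add_right_iff)
    with dvd have "degree F \<le> i" by (meson not_le)
    with le have "degree g = 0" using nz unfolding F by (simp add: degree_mult_eq)
    then obtain c where "g = [:c:]" by (rule degree_eq_zeroE)
    with lead have "c dvd 1" by (metis dvd_triv_right lead_coeff_pCons(2))
    with \<open>g = [:c:]\<close> show ?thesis by (simp add: is_unit_const_poly_iff)
  qed
  fix a b assume F: "F = a * b"
  have "p dvd coeff a 0 * coeff b 0"
    using dvd[OF deg] unfolding F by (simp add: coeff_mult_0)
  with p have "p dvd coeff a 0 \<or> p dvd coeff b 0" by (simp add: prime_elem_dvd_mult_iff)
  with *[OF F] *[of b a] F show "is_unit a \<or> is_unit b" by (auto simp: mult.commute)
qed

text \<open>The shift by \<open>c\<close> is a ring automorphism with inverse the shift by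
  \<open>-c\<close>, so it carries units and factorizations both ways.\<close>

lemma irreducible_pcompose_linearD:
  fixes f :: "'a :: idom_divide poly"
  assumes "irreducible (pcompose f [:c, 1:])"
  shows "irreducible f"
proof (rule irreducibleI)
  have inverse: "pcompose (pcompose g [:c, 1:]) [:-c, 1:] = g" for g :: "'a poly"
    by (simp add: pcompose_assoc[symmetric] pcompose_pCons)
  have unit: "is_unit (pcompose g [:d, 1:])" if "is_unit g" for g :: "'a poly" and d
    using that by (auto simp: is_unit_poly_iff)
  show "f \<noteq> 0" using assms by auto
  show "\<not> is_unit f" using assms unit irreducible_not_unit by blast
  fix a b assume "f = a * b"
  hence "pcompose f [:c, 1:] = pcompose a [:c, 1:] * pcompose b [:c, 1:]"
    by (simp add: pcompose_mult)
  from irreducibleD[OF assms this] show "is_unit a \<or> is_unit b"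
    using unit[of "pcompose a [:c, 1:]" "-c"] unit[of "pcompose b [:c, 1:]" "-c"] by (auto simp: inverse)
qed

lemma prime_dvd_freshman:
  fixes x y :: "'a :: comm_ring_1"
  assumes "prime p"
  shows "of_nat p dvd (x + y) ^ (p ^ n) - (x ^ (p ^ n) + y ^ (p ^ n))"
proof (induction n)
  case (Suc n)
  have base: "of_nat p dvd (u + v) ^ p - (u ^ p + v ^ p)" for u v :: 'a
  proof -
    have p0: "0 < p" using assms prime_gt_0_nat by blast
    have "(u + v) ^ p = (\<Sum>k\<le>p. of_nat (p choose k) * u ^ k * v ^ (p - k))"
      by (rule binomial_ring)
    also have "\<dots> = (\<Sum>k\<in>{..p} - {0, p}. of_nat (p choose k) * u ^ k * v ^ (p - k)) + (u ^ p + v ^ p)"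
      using p0 by (subst sum.subset_diff[of "{0, p}"]) (auto simp: add.commute)
    finally have "(u + v) ^ p - (u ^ p + v ^ p) =
      (\<Sum>k\<in>{..p} - {0, p}. of_nat (p choose k) * u ^ k * v ^ (p - k))" by simp
    also have "of_nat p dvd \<dots>"
    proof (rule dvd_sum)
      fix k assume "k \<in> {..p} - {0, p}"
      hence "p dvd (p choose k)" using assms p0 by (intro dvd_choose_prime) auto
      hence "(of_nat p :: 'a) dvd of_nat (p choose k)" by (auto elim!: dvdE)
      thus "(of_nat p :: 'a) dvd of_nat (p choose k) * u ^ k * v ^ (p - k)" by simp
    qed
    finally show ?thesis .
  qed
  define a b where "a = (x + y) ^ (p ^ n)" and "b = x ^ (p ^ n) + y ^ (p ^ n)"
  \<comment> \<open>Congruence modulo \<open>p\<close> survives taking \<open>p\<close>-th powers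
    because \<open>a - b\<close> divides \<open>a ^ p - b ^ p\<close>.\<close>
  have "of_nat p dvd a ^ p - b ^ p"
    using Suc.IH unfolding a_def[symmetric] b_def[symmetric]
    by (rule dvd_trans) (simp add: power_diff_sumr2)
  moreover have "of_nat p dvd b ^ p - ((x ^ (p ^ n)) ^ p + (y ^ (p ^ n)) ^ p)"
    unfolding b_def by (rule base)
  ultimately have "of_nat p dvd (a ^ p - b ^ p) + (b ^ p - ((x ^ (p ^ n)) ^ p + (y ^ (p ^ n)) ^ p))"
    by (rule dvd_add)
  hence "of_nat p dvd a ^ p - ((x ^ (p ^ n)) ^ p + (y ^ (p ^ n)) ^ p)"
    by (simp add: algebra_simps)
  thus ?case by (simp add: a_def power_mult[symmetric] mult.commute)
qed simp

text \<open>The cyclotomic polynomial of order \<open>p^(n+1)\<close>.\<close>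

definition cyclotomic_pp :: "nat \<Rightarrow> nat \<Rightarrow> int poly" where
  "cyclotomic_pp p n = (\<Sum>j<p. monom 1 (p ^ n * j))"

lemma cyclotomic_pp_mult:
  "(monom 1 (p ^ n) - 1) * cyclotomic_pp p n = monom 1 (p ^ Suc n) - 1"
  using power_diff_1_eq[of "monom (1::int) (p ^ n)" p]
  by (simp add: cyclotomic_pp_def monom_power mult.commute)

lemma poly_cyclotomic_pp_1 [simp]: "poly (cyclotomic_pp p n) 1 = int p"
  by (simp add: cyclotomic_pp_def poly_sum poly_monom)

lemma coeff_cyclotomic_pp_nonneg: "coeff (cyclotomic_pp p n) i \<ge> 0"
  by (simp add: cyclotomic_pp_def coeff_sum sum_nonneg)

lemma
  assumes "prime p"
  shows degree_cyclotomic_pp: "degree (cyclotomic_pp p n) = p ^ n * (p - 1)"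
    and lead_coeff_cyclotomic_pp: "lead_coeff (cyclotomic_pp p n) = 1"
proof -
  have p: "p > 1" using assms prime_gt_1_nat by blast
  obtain r where r: "p = Suc r" using p by (cases p) auto
  have q: "p ^ n > 0" using p by simp
  have eq: "coeff (cyclotomic_pp p n) (p ^ n * r) = 1"
  proof -
    have "coeff (cyclotomic_pp p n) (p ^ n * r) = (\<Sum>j<p. if j = r then 1 else 0)"
      unfolding cyclotomic_pp_def coeff_sum using p by (intro sum.cong) auto
    thus ?thesis by (simp add: r)
  qed
  have le: "degree (cyclotomic_pp p n) \<le> p ^ n * r"
    unfolding cyclotomic_pp_def
    by (intro degree_sum_le order.trans[OF degree_monom_le]) (auto simp: r)
  have "p ^ n * r \<le> degree (cyclotomic_pp p n)" by (rule le_degree) (simp add: eq)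
  with le have "degree (cyclotomic_pp p n) = p ^ n * r" by simp
  thus "degree (cyclotomic_pp p n) = p ^ n * (p - 1)" "lead_coeff (cyclotomic_pp p n) = 1"
    using eq r by simp_all
qed

text \<open>Eisenstein applies after the shift to X + 1. With q = p^n, the shifted polynomial
  satisfies ((X+1)^q - 1) F = (X+1)^(qp) - 1, which modulo p reads X^q F = X^(qp), so all
  coefficients of F below the leading one vanish modulo p.\<close>

lemma irreducible_cyclotomic_pp:
  assumes p: "prime p"
  shows "irreducible (cyclotomic_pp p n)"
proof (rule irreducible_pcompose_linearD)
  define q where "q = p ^ n"
  define F where "F = pcompose (cyclotomic_pp p n) [:1, 1:]"
  let ?X = "[:0, 1:] :: int poly"
  have p1: "p > 1" using p prime_gt_1_nat by blast
  have shift: "pcompose (monom 1 m) [:1, 1:] = (?X + 1) ^ m" for m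
  proof (induction m)
    case (Suc m)
    thus ?case by (simp add: monom_Suc pcompose_pCons one_pCons)
  qed (simp add: monom_0 one_pCons)
  have deg: "degree F = q * (p - 1)"
    unfolding F_def q_def by (simp add: degree_pcompose degree_cyclotomic_pp[OF p])
  have monic: "lead_coeff F = 1"
    unfolding F_def by (simp add: lead_coeff_comp lead_coeff_cyclotomic_pp[OF p])
  have "pcompose ((monom 1 q - 1) * cyclotomic_pp p n) [:1, 1:] = pcompose (monom 1 (q * p) - 1) [:1, 1:]"
    unfolding q_def using cyclotomic_pp_mult[of p n] by (simp add: mult.commute)
  hence F: "((?X + 1) ^ q - 1) * F = (?X + 1) ^ (q * p) - 1"
    by (simp add: pcompose_mult pcompose_diff shift F_def pcompose_1)
  have fr: "of_nat p dvd (?X + 1) ^ q - (?X ^ q + 1)"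
      "of_nat p dvd (?X + 1) ^ (q * p) - (?X ^ (q * p) + 1)"
    using prime_dvd_freshman[OF p, of ?X 1 n] prime_dvd_freshman[OF p, of ?X 1 "Suc n"]
    by (simp_all only: q_def power_one power_Suc2)
  have "of_nat p dvd ((?X + 1) ^ (q * p) - (?X ^ (q * p) + 1)) - ((?X + 1) ^ q - (?X ^ q + 1)) * F"
    using fr by (rule dvd_diff[OF _ dvd_mult2, rotated])
  also have "\<dots> = monom 1 q * F - monom 1 (q * p)"
    using F by (simp add: algebra_simps monom_altdef)
  finally have dvd: "[:int p:] dvd monom 1 q * F - monom 1 (q * p)" by (simp add: of_nat_poly)
  have dvdF: "int p dvd coeff F i" if "i < degree F" for i
  proof -
    \<comment> \<open>Below \<open>degree F\<close> the monomial of degree \<open>q * p\<close> does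
      not interfere.\<close>
    have "q * p = q + degree F" unfolding deg using p1 by (cases p) auto
    hence "q + i \<noteq> q * p" using that by simp
    moreover have "int p dvd coeff (monom 1 q * F - monom 1 (q * p)) (q + i)"
      using dvd unfolding const_poly_dvd_iff by blast
    ultimately show ?thesis by (simp add: coeff_monom_mult)
  qed
  \<comment> \<open>The constant term after the shift is the value at 1 before it.\<close>
  have "coeff F 0 = int p"
    unfolding F_def by (simp add: coeff_pcompose_0)
  hence "\<not> int p ^ 2 dvd coeff F 0"
    using p1 by (auto simp: power2_eq_square dest: zdvd_imp_le)
  thus "irreducible F"
    using p p1 deg monic dvdF by (intro irreducible_eisenstein[of "int p"]) (auto simp: q_def)
qed

text \<open>\<open>prime\<close> also demands a normalized element; being monic settles the
  sign.\<close>

lemma prime_cyclotomic_pp: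
  assumes "prime p"
  shows "prime (cyclotomic_pp p n)"
  unfolding prime_def
  using irreducible_cyclotomic_pp[OF assms] lead_coeff_cyclotomic_pp[OF assms]
  by (simp add: irreducible_imp_prime_elem normalize_poly_eq_map_poly)

lemma inj_cyclotomic_pp:
  assumes "prime p"
  shows "inj (cyclotomic_pp p)"
proof (rule injI)
  fix i j assume "cyclotomic_pp p i = cyclotomic_pp p j"
  hence "p ^ i * (p - 1) = p ^ j * (p - 1)" using degree_cyclotomic_pp[OF assms] by metis
  thus "i = j" using prime_gt_1_nat[OF assms] by (simp add: power_inject_exp)
qed

text \<open>Multiplied by X - 1, the product telescopes to X^(p^k) - 1; then X - 1 is
  cancelled.\<close>

lemma prod_cyclotomic_pp:
  assumes "prime p"
  shows "(\<Prod>i<k. cyclotomic_pp p i) = (\<Sum>j<p ^ k. monom 1 j)"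
proof -
  have "(monom 1 1 - 1) * (\<Prod>i<k. cyclotomic_pp p i) = monom 1 (p ^ k) - 1"
  proof (induction k)
    case (Suc k)
    thus ?case using cyclotomic_pp_mult[of p k] by (simp add: mult.assoc[symmetric])
  qed simp
  also have "\<dots> = (monom 1 1 - 1) * (\<Sum>j<p ^ k. monom 1 j)"
    using power_diff_1_eq[of "monom (1::int) 1" "p ^ k"] by (simp add: monom_power)
  finally show ?thesis
    by (simp add: monom_eq_1_iff)
qed

subsection \<open>Divisors of products of prime powers\<close>

lemma multiplicity_prod_distinct_primes:
  fixes c :: "'i \<Rightarrow> 'a :: factorial_semiring"
  assumes "finite I" "inj_on c I" "\<And>i. i \<in> I \<Longrightarrow> prime (c i)" "j \<in> I"
  shows "multiplicity (c j) (\<Prod>i\<in>I. c i ^ n i) = n j"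
proof -
  \<comment> \<open>Reindexing by the primes themselves makes the multiplicity rule for prime power
    products applicable.\<close>
  have eq: "(\<Prod>i\<in>I. c i ^ n i) = (\<Prod>q\<in>c ` I. q ^ n (the_inv_into I c q))"
    using assms by (simp add: prod.reindex the_inv_into_f_f)
  show ?thesis
    unfolding eq using assms by (subst multiplicity_prod_prime_powers[where S = "c ` I"]) (auto simp: the_inv_into_f_f)
qed

text \<open>Each prime factor of \<open>P\<close> divides the product, hence equals some
  \<open>c i\<close>. The factorization determines \<open>P\<close> only up to a unit, hence
  \<open>normalize\<close>.\<close>

lemma dvd_prod_distinct_primes:
  fixes c :: "'i \<Rightarrow> 'a :: factorial_semiring"
  assumes "finite I" "inj_on c I" "\<And>i. i \<in> I \<Longrightarrow> prime (c i)" and P: "P dvd (\<Prod>i\<in>I. c i ^ n i)"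
  shows "normalize (\<Prod>i\<in>I. c i ^ multiplicity (c i) P) = normalize P"
    and "\<And>i. i \<in> I \<Longrightarrow> multiplicity (c i) P \<le> n i"
proof -
  have nz: "(\<Prod>i\<in>I. c i ^ n i) \<noteq> 0" using assms by (auto dest: prime_elem_not_zeroI)
  hence P0: "P \<noteq> 0" using P by auto
  have sub: "prime_factors P \<subseteq> c ` I"
  proof
    fix q assume "q \<in> prime_factors P"
    hence q: "prime q" "q dvd P" by auto
    hence "q dvd (\<Prod>i\<in>I. c i ^ n i)" using P dvd_trans by blast
    then obtain i where i: "i \<in> I" "q dvd c i ^ n i"
      using q(1) assms(1) by (auto simp: prime_dvd_prod_iff)
    hence "q dvd c i" using q(1) prime_dvd_power by blast
    hence "q = c i" using q(1) assms(3)[OF i(1)] primes_dvd_imp_eq by blast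
    thus "q \<in> c ` I" using i(1) by simp
  qed
  have "prod_mset (prime_factorization P) = (\<Prod>q\<in>prime_factors P. q ^ multiplicity q P)"
    unfolding prod_mset_multiplicity
    by (intro prod.cong) (auto simp: count_prime_factorization)
  also have "\<dots> = (\<Prod>q\<in>c ` I. q ^ multiplicity q P)"
    using sub assms P0 by (intro prod.mono_neutral_left)
      (auto simp: prime_factors_multiplicity)
  also have "\<dots> = (\<Prod>i\<in>I. c i ^ multiplicity (c i) P)"
    using assms by (simp add: prod.reindex)
  finally show "normalize (\<Prod>i\<in>I. c i ^ multiplicity (c i) P) = normalize P"
    using prod_mset_prime_factorization_weak[OF P0] by simp
  show "multiplicity (c i) P \<le> n i" if "i \<in> I" for i
    using dvd_imp_multiplicity_le[OF P nz, of "c i"]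
      multiplicity_prod_distinct_primes[OF assms(1-3) that] by simp
qed

subsection \<open>Generating polynomials of dice\<close>

definition dice_poly :: "nat multiset \<Rightarrow> int poly" where
  "dice_poly A = (\<Sum>a\<in>#A. monom 1 a)"

lemma dice_poly_simps [simp]:
  "dice_poly {#} = 0" "dice_poly (add_mset a A) = monom 1 a + dice_poly A"
  "dice_poly (A + B) = dice_poly A + dice_poly B"
  by (simp_all add: dice_poly_def)

lemma coeff_dice_poly [simp]: "coeff (dice_poly A) n = int (count A n)"
  by (induction A) auto

lemma dice_poly_eq_iff [simp]: "dice_poly A = dice_poly B \<longleftrightarrow> A = B"
  by (auto simp: poly_eq_iff multiset_eq_iff)

lemma poly_dice_poly_1 [simp]: "poly (dice_poly A) 1 = int (size A)"
  by (induction A) (auto simp: poly_monom)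

lemma dice_poly_dice_sums: "dice_poly (dice_sums A B) = dice_poly A * dice_poly B"
proof (induction A)
  case (add a A)
  have "dice_poly {# a + b. b \<in># B #} = monom 1 a * dice_poly B"
    by (induction B) (auto simp: mult_monom distrib_left)
  with add show ?case by (simp add: dice_sums_def distrib_right)
qed (simp add: dice_sums_def)

text \<open>The coefficients themselves serve as multiplicities; this turns products of cyclotomic
  polynomials back into dice.\<close>

lemma dice_poly_surj:
  assumes "\<And>i. coeff P i \<ge> 0"
  obtains A where "dice_poly A = P"
proof
  have fin: "finite {i. coeff P i \<noteq> 0}"
    by (metis MOST_coeff_eq_0 eventually_cofinite)
  have "finite {i. nat (coeff P i) > 0}" by (rule finite_subset[OF _ fin]) auto
  thus "dice_poly (Abs_multiset (\<lambda>i. nat (coeff P i))) = P"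
    using assms by (simp add: poly_eq_iff)
qed

lemma dice_poly_standard_dice: "dice_poly (standard_dice m) = (\<Sum>i\<in>{1..m}. monom 1 i)"
  by (simp add: dice_poly_def standard_dice_def sum_unfold_sum_mset)

text \<open>The pair counts are the multiplicities of sums of two standard dice, and
  \<open>dice_poly\<close> is injective and turns \<open>dice_sums\<close> into a product.\<close>

lemma standard_sums_iff:
  "standard_sums m A B \<longleftrightarrow> dice_poly A * dice_poly B = dice_poly (standard_dice m) ^ 2"
proof -
  have "count (dice_sums (standard_dice m) (standard_dice m)) s =
      card {(i, j) \<in> {1..m} \<times> {1..m}. i + j = s}" for s
  proof -
    have "count (dice_sums (standard_dice m) (standard_dice m)) s = (\<Sum>i\<in>{1..m}. \<Sum>j\<in>{1..m}. if i + j = s then 1 else 0)"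
    proof -
      have "int (count (dice_sums (standard_dice m) (standard_dice m)) s) =
        coeff ((\<Sum>i\<in>{1..m}. monom 1 i) * (\<Sum>j\<in>{1..m}. monom 1 j)) s"
        unfolding coeff_dice_poly[symmetric] dice_poly_dice_sums
        by (simp add: dice_poly_standard_dice)
      also have "\<dots> = int (\<Sum>i\<in>{1..m}. \<Sum>j\<in>{1..m}. if i + j = s then 1 else 0)"
        by (simp add: sum_product coeff_sum mult_monom of_nat_sum if_distrib[of int] cong: if_cong)
      finally show ?thesis by (simp only: of_nat_eq_iff)
    qed
    also have "\<dots> = (\<Sum>x\<in>{1..m} \<times> {1..m}. if fst x + snd x = s then 1 else 0)"
      by (simp add: sum.cartesian_product case_prod_beta)
    also have "\<dots> = card {x \<in> {1..m} \<times> {1..m}. fst x + snd x = s}"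
      by (simp add: sum.If_cases Int_def)
    also have "{x \<in> {1..m} \<times> {1..m}. fst x + snd x = s} = {(i, j) \<in> {1..m} \<times> {1..m}. i + j = s}"
      by auto
    finally show ?thesis .
  qed
  hence "standard_sums m A B \<longleftrightarrow> dice_sums A B = dice_sums (standard_dice m) (standard_dice m)"
    by (simp add: standard_sums_def multiset_eq_iff)
  also have "\<dots> \<longleftrightarrow> dice_poly (dice_sums A B) = dice_poly (dice_sums (standard_dice m) (standard_dice m))"
    by simp
  finally show ?thesis by (simp only: dice_poly_dice_sums power2_eq_square)
qed

lemma is_dice_iff:
  "is_dice m A \<longleftrightarrow> poly (dice_poly A) 1 = int m \<and> coeff (dice_poly A) 0 = 0"
  by (auto simp: is_dice_def not_in_iff[symmetric] intro: gr0I)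


subsection \<open>Trinomial coefficients\<close>

text \<open>The sum of the coefficients of \<open>x^j\<close> in \<open>(x^-1 + 1 + x)^k\<close> over all \<open>j\<close> with \<open>P j\<close>;
  an exponent \<open>e i\<close> encodes the choice of the term \<open>x^(e i - 1)\<close> from the \<open>i\<close>-th factor.\<close>

definition tcount :: "nat \<Rightarrow> (int \<Rightarrow> bool) \<Rightarrow> nat" where
  "tcount k P = card {e \<in> {..<k} \<rightarrow>\<^sub>E {..2::nat}. P (int (sum e {..<k}) - int k)}"

lemma tcount_0: "tcount 0 P = (if P 0 then 1 else 0)"
  by (simp add: tcount_def)

text \<open>Condition on the exponent \<open>j\<close> chosen at the new index \<open>k\<close>: it
  shifts the total by \<open>j - 1\<close>.\<close>

lemma tcount_Suc:
  "tcount (Suc k) P = tcount k (\<lambda>x. P (x - 1)) + tcount k P + tcount k (\<lambda>x. P (x + 1))"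
proof -
  define E where "E = (\<lambda>j. {e \<in> {..<k} \<rightarrow>\<^sub>E {..2::nat}. P (int (sum e {..<k}) - int k + (int j - 1))})"
  define ext where "ext = (\<lambda>(j::nat, e). e(k := j) :: nat \<Rightarrow> nat)"
  have fin: "finite (E j)" for j
    unfolding E_def by (simp add: finite_PiE)
  have sum: "sum (e(k := j)) {..<k} = sum e {..<k}" for e :: "nat \<Rightarrow> nat" and j
    by (intro sum.cong) auto
  have inj: "inj_on ext (SIGMA j:{..2}. E j)"
    unfolding ext_def E_def
    by (rule inj_on_subset[OF inj_combinator[of k "{..<k}" "\<lambda>_. {..2}"]]) auto
  have PiE: "{..<Suc k} \<rightarrow>\<^sub>E {..2::nat} = ext ` ({..2} \<times> ({..<k} \<rightarrow>\<^sub>E {..2}))"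
    unfolding lessThan_Suc PiE_insert_eq ext_def by simp
  have image: "{e \<in> ext ` X. Q e} = ext ` {x \<in> X. Q (ext x)}" for X Q
    by auto
  have sum_ext: "int (sum (ext x) {..<Suc k}) - int (Suc k) =
      int (sum (snd x) {..<k}) - int k + (int (fst x) - 1)" for x
    by (simp add: ext_def case_prod_beta sum)
  have "{e \<in> {..<Suc k} \<rightarrow>\<^sub>E {..2::nat}. P (int (sum e {..<Suc k}) - int (Suc k))} = ext ` (SIGMA j:{..2}. E j)"
  proof -
    have "{x \<in> {..2} \<times> ({..<k} \<rightarrow>\<^sub>E {..2}). P (int (sum (snd x) {..<k}) - int k + (int (fst x) - 1))} = (SIGMA j:{..2}. E j)"
      unfolding E_def Sigma_def by fastforce
    thus ?thesis
      by (simp only: PiE image sum_ext)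
  qed
  hence "tcount (Suc k) P = card (SIGMA j:{..2}. E j)"
    unfolding tcount_def using card_image[OF inj] by simp
  also have "\<dots> = (\<Sum>j\<le>2. card (E j))"
    using fin by simp
  also have "\<dots> = card (E 0) + card (E 1) + card (E 2)"
    by (simp add: numeral_2_eq_2)
  finally show ?thesis by (simp add: tcount_def E_def)
qed

lemma tcount_disjoint_le:
  assumes "\<And>x. P x \<Longrightarrow> R x" "\<And>x. Q x \<Longrightarrow> R x" "\<And>x. P x \<Longrightarrow> \<not> Q x"
  shows "tcount k P + tcount k Q \<le> tcount k R"
proof -
  let ?A = "\<lambda>P. {e \<in> {..<k} \<rightarrow>\<^sub>E {..2::nat}. P (int (sum e {..<k}) - int k)}"
  have fin: "finite (?A P)" for P by (simp add: finite_PiE)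
  have "card (?A P) + card (?A Q) = card (?A P \<union> ?A Q)"
    by (rule card_Un_disjoint[symmetric, OF fin fin]) (use assms(3) in blast)
  also have "\<dots> \<le> card (?A R)"
    by (rule card_mono[OF fin]) (use assms(1,2) in blast)
  finally show ?thesis by (simp add: tcount_def)
qed

abbreviation trinom :: "nat \<Rightarrow> int \<Rightarrow> nat" where
  "trinom k j \<equiv> tcount k (\<lambda>x. x = j)"

lemma trinom_Suc: "trinom (Suc k) j = trinom k (j + 1) + trinom k j + trinom k (j - 1)"
proof -
  have "(\<lambda>x::int. x - 1 = j) = (\<lambda>x. x = j + 1)" "(\<lambda>x::int. x + 1 = j) = (\<lambda>x. x = j - 1)"
    by auto
  thus ?thesis by (simp add: tcount_Suc)
qed

lemma trinom_uminus: "trinom k (-j) = trinom k j"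
proof (induction k arbitrary: j)
  case (Suc k)
  from Suc[of "j + 1"] Suc[of "j - 1"] Suc[of j] show ?case by (simp add: trinom_Suc)
qed (simp add: tcount_0)

lemma trinom_abs: "trinom k \<bar>j\<bar> = trinom k j"
  by (simp add: abs_if trinom_uminus)

lemma trinom_antimono:
  assumes "\<bar>i\<bar> \<le> \<bar>j\<bar>"
  shows "trinom k j \<le> trinom k i"
proof -
  have step: "trinom k (int n + 1) \<le> trinom k (int n)" for n
  proof (induction k arbitrary: n)
    case (Suc k)
    have mono: "trinom k (int b) \<le> trinom k (int a)" if "a \<le> b" for a b
      using lift_Suc_antimono_le[of "\<lambda>n. trinom k (int n)", OF _ that] Suc by (simp add: add.commute)
    \<comment> \<open>The recurrences at n + 1 and n share two of their three terms, so only the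
      coefficients at n + 2 and n - 1 need comparing. The absolute value covers n = 0.\<close>
    have "trinom k (int (n + 2)) \<le> trinom k (int (nat \<bar>int n - 1\<bar>))"
      by (rule mono) linarith
    also have "int (n + 2) = int n + 1 + 1" by simp
    finally have "trinom k (int n + 1 + 1) \<le> trinom k (int n - 1)" by (simp add: trinom_abs)
    thus ?case by (simp add: trinom_Suc)
  qed (simp add: tcount_0)
  have "trinom k (int (nat \<bar>j\<bar>)) \<le> trinom k (int (nat \<bar>i\<bar>))"
  proof (rule lift_Suc_antimono_le[of "\<lambda>n. trinom k (int n)"])
    show "trinom k (int (Suc n)) \<le> trinom k (int n)" for n
      using step[of n] by (simp add: add.commute)
    show "nat \<bar>i\<bar> \<le> nat \<bar>j\<bar>" using assms by simp
  qed
  thus ?thesis by (simp add: trinom_abs)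
qed

lemma trinom_eq_0: "\<bar>j\<bar> > int k \<Longrightarrow> trinom k j = 0"
  by (induction k arbitrary: j) (auto simp: tcount_0 trinom_Suc)

lemma trinom_top: "trinom k (int k) = 1"
proof (induction k)
  case (Suc k)
  thus ?case by (simp add: trinom_Suc trinom_eq_0)
qed (simp add: tcount_0)

lemma trinom_pos: "\<bar>j\<bar> \<le> int k \<Longrightarrow> trinom k j > 0"
  using trinom_antimono[of j "int k" k] by (simp add: trinom_top)

section \<open>Estimates for the central trinomial coefficient\<close>

lemma sum_trinom: "(\<Sum>j=-int k..int k. trinom k j) = 3 ^ k"
proof -
  let ?A = "\<lambda>j. {e \<in> {..<k} \<rightarrow>\<^sub>E {..2::nat}. int (sum e {..<k}) - int k = j}"
  have "(\<Sum>j=-int k..int k. trinom k j) = card (\<Union>j\<in>{-int k..int k}. ?A j)"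
    unfolding tcount_def by (subst card_UN_disjoint) (auto simp: finite_PiE)
  also have "(\<Union>j\<in>{-int k..int k}. ?A j) = {..<k} \<rightarrow>\<^sub>E {..2::nat}"
  proof -
    have le: "sum e {..<k} \<le> 2 * k" if "e \<in> {..<k} \<rightarrow>\<^sub>E {..2::nat}" for e
      using sum_bounded_above[of "{..<k}" e 2] that by (auto simp: PiE_iff mult.commute)
    have "int (sum e {..<k}) - int k \<in> {-int k..int k}" if "e \<in> {..<k} \<rightarrow>\<^sub>E {..2::nat}" for e
      unfolding atLeastAtMost_iff using le[OF that] by linarith
    thus ?thesis by auto
  qed
  also have "card \<dots> = 3 ^ k" by (simp add: card_PiE)
  finally show ?thesis .
qed

lemma pow3_le_central_trinom:
  assumes "k > 0"
  shows "3 ^ k \<le> (2 * k - 1) * trinom k 0 + 2"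
proof -
  have eq: "{-int k..int k} = insert (int k) (insert (-int k) {-int k<..<int k})" by auto
  have "3 ^ k = 2 + (\<Sum>j\<in>{-int k<..<int k}. trinom k j)"
    unfolding sum_trinom[symmetric] eq using assms
    by (simp add: trinom_top trinom_uminus)
  also have "(\<Sum>j\<in>{-int k<..<int k}. trinom k j) \<le> card {-int k<..<int k} * trinom k 0"
    using sum_bounded_above[of "{-int k<..<int k}" "trinom k" "trinom k 0"] trinom_antimono[of 0] by simp
  also have "card {-int k<..<int k} = 2 * k - 1" using assms by simp
  finally show ?thesis by simp
qed

text \<open>These values come from evaluating (x^-1 + 1 + x)^k at the fourth roots of unity: 3^k at
  1, (-1)^k at -1, and 1 at i and -i. The four classes feed one another in the recurrence, so they
  are proved together.\<close>

lemma tcount_mod4: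
  "4 * int (tcount k (\<lambda>x. x mod 4 = 0)) = 3 ^ k + (-1) ^ k + 2"
  "4 * int (tcount k (\<lambda>x. x mod 4 = 1)) = 3 ^ k - (-1) ^ k"
  "4 * int (tcount k (\<lambda>x. x mod 4 = 2)) = 3 ^ k + (-1) ^ k - 2"
  "4 * int (tcount k (\<lambda>x. x mod 4 = 3)) = 3 ^ k - (-1) ^ k"
proof (induction k)
  case (Suc k)
  have shift: "(\<lambda>x::int. (x - 1) mod 4 = 0) = (\<lambda>x. x mod 4 = 1)" "(\<lambda>x::int. (x + 1) mod 4 = 0) = (\<lambda>x. x mod 4 = 3)"
    "(\<lambda>x::int. (x - 1) mod 4 = 1) = (\<lambda>x. x mod 4 = 2)" "(\<lambda>x::int. (x + 1) mod 4 = 1) = (\<lambda>x. x mod 4 = 0)"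
    "(\<lambda>x::int. (x - 1) mod 4 = 2) = (\<lambda>x. x mod 4 = 3)" "(\<lambda>x::int. (x + 1) mod 4 = 2) = (\<lambda>x. x mod 4 = 1)"
    "(\<lambda>x::int. (x - 1) mod 4 = 3) = (\<lambda>x. x mod 4 = 0)" "(\<lambda>x::int. (x + 1) mod 4 = 3) = (\<lambda>x. x mod 4 = 2)"
    by (rule ext, presburger)+
  {
    case 1 show ?case using Suc.IH by (simp add: tcount_Suc shift)
  next
    case 2 show ?case using Suc.IH by (simp add: tcount_Suc shift)
  next
    case 3 show ?case using Suc.IH by (simp add: tcount_Suc shift)
  next
    case 4 show ?case using Suc.IH by (simp add: tcount_Suc shift)
  }
qed (simp_all add: tcount_0)

lemma central_trinom_less:
  assumes "k \<ge> 4"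
  shows "4 * int (trinom k 0) < 3 ^ k + (-1) ^ k + 2"
proof -
  have "trinom k 0 + trinom k 4 \<le> tcount k (\<lambda>x. x mod 4 = 0)"
    by (rule tcount_disjoint_le) auto
  hence "4 * int (trinom k 0) + 4 * int (trinom k 4) \<le> 3 ^ k + (-1) ^ k + 2"
    unfolding tcount_mod4(1)[symmetric] by linarith
  \<comment> \<open>Strictness comes from the exponent 4, which lies in the support as
    \<open>k \<ge> 4\<close>.\<close>
  moreover have "trinom k 4 > 0" using assms by (intro trinom_pos) simp
  ultimately show ?thesis by linarith
qed

text \<open>This is the rearranged form of (3^k - 1)/(2k) < (3^k - 2)/(2k - 1) - 1, the comparison
  needed for the lower bound.\<close>

lemma four_squares_less_pow3:
  assumes "(k::nat) \<ge> 4"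
  shows "4 * k ^ 2 + 1 < (3::nat) ^ k"
  using assms
proof (induction k rule: dec_induct)
  case (step k)
  have "4 * k \<le> k * k" using step(1) by (rule mult_right_mono) simp
  moreover have "4 * Suc k ^ 2 + 1 = 4 * (k * k) + 8 * k + 5"
    by (simp add: power2_eq_square)
  ultimately have "4 * Suc k ^ 2 + 1 \<le> 12 * (k * k) + 3" using step(1) by linarith
  also have "\<dots> = 3 * (4 * k ^ 2 + 1)" by (simp add: power2_eq_square)
  finally show ?case using step.IH by simp
qed simp

subsection \<open>Solutions for prime power dice-size\<close>

definition solution_poly :: "nat \<Rightarrow> nat \<Rightarrow> (nat \<Rightarrow> nat) \<Rightarrow> int poly" where
  "solution_poly p k e = monom 1 1 * (\<Prod>i<k. cyclotomic_pp p i ^ e i)"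

lemma dice_poly_standard_prime_power:
  assumes "prime p"
  shows "dice_poly (standard_dice (p ^ k)) = solution_poly p k (\<lambda>_. 1)"
proof -
  have "solution_poly p k (\<lambda>_. 1) = (\<Sum>j<p ^ k. monom 1 (Suc j))"
    by (simp add: solution_poly_def prod_cyclotomic_pp[OF assms] sum_distrib_left mult_monom)
  also have "\<dots> = dice_poly (standard_dice (p ^ k))"
    by (simp add: dice_poly_standard_dice sum.atLeast1_atMost_eq)
  finally show ?thesis by simp
qed

lemma coeff_mult_nonneg:
  fixes P Q :: "'a :: linordered_idom poly"
  assumes "\<And>i. coeff P i \<ge> 0" "\<And>i. coeff Q i \<ge> 0"
  shows "coeff (P * Q) n \<ge> 0"
  using assms by (simp add: coeff_mult sum_nonneg)

lemma coeff_solution_poly_nonneg: "coeff (solution_poly p k e) n \<ge> 0"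
proof -
  have pow: "coeff (cyclotomic_pp p i ^ m) n \<ge> 0" for i m n
    by (induction m arbitrary: n) (auto intro!: coeff_mult_nonneg coeff_cyclotomic_pp_nonneg)
  have "coeff (\<Prod>i<k. cyclotomic_pp p i ^ e i) n \<ge> 0" for n
    by (induction k arbitrary: n) (auto intro!: coeff_mult_nonneg pow)
  thus ?thesis unfolding solution_poly_def by (intro coeff_mult_nonneg) auto
qed

lemma poly_solution_poly_1: "poly (solution_poly p k e) 1 = int p ^ sum e {..<k}"
  by (simp add: solution_poly_def poly_monom poly_prod power_sum)

lemma coeff_solution_poly_0: "coeff (solution_poly p k e) 0 = 0"
  by (simp add: solution_poly_def coeff_mult_0)

text \<open>Complementary exponents supply the partner of a solution.\<close>

lemma solution_poly_mult:
  assumes "\<And>i. i < k \<Longrightarrow> e i + f i = 2"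
  shows "solution_poly p k e * solution_poly p k f = solution_poly p k (\<lambda>_. 1) ^ 2"
proof -
  have "(\<Prod>i<k. cyclotomic_pp p i ^ e i) * (\<Prod>i<k. cyclotomic_pp p i ^ f i) =
    (\<Prod>i<k. cyclotomic_pp p i) ^ 2"
    unfolding prod.distrib[symmetric] prod_power_distrib
    using assms by (intro prod.cong) (auto simp flip: power_add)
  thus ?thesis by (simp add: solution_poly_def power2_eq_square algebra_simps)
qed

text \<open>The extensional function space fixes values outside \<open>{..<k}\<close>, so distinct
  functions are distinct exponent vectors.\<close>

definition exponents :: "nat \<Rightarrow> (nat \<Rightarrow> nat) set" where
  "exponents k = {e \<in> {..<k} \<rightarrow>\<^sub>E {..2}. sum e {..<k} = k}"

lemma card_exponents: "card (exponents k) = trinom k 0"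
  by (simp add: exponents_def tcount_def flip: of_nat_sum)

lemma inj_on_solution_poly:
  assumes p: "prime p"
  shows "inj_on (solution_poly p k) (exponents k)"
proof (rule inj_onI)
  fix e f assume e: "e \<in> exponents k" and f: "f \<in> exponents k"
    and "solution_poly p k e = solution_poly p k f"
  hence eq: "(\<Prod>i<k. cyclotomic_pp p i ^ e i) = (\<Prod>i<k. cyclotomic_pp p i ^ f i)"
    by (simp add: solution_poly_def)
  \<comment> \<open>Each exponent is recovered as the multiplicity of its cyclotomic prime.\<close>
  have "e i = f i" if "i < k" for i
    using multiplicity_prod_distinct_primes[of "{..<k}" "cyclotomic_pp p" i e]
      multiplicity_prod_distinct_primes[of "{..<k}" "cyclotomic_pp p" i f] that eq
      prime_cyclotomic_pp[OF p] inj_on_subset[OF inj_cyclotomic_pp[OF p]] by simp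
  thus "e = f"
    using e f by (intro PiE_ext[of e "{..<k}" "\<lambda>_. {..2}" f]) (auto simp: exponents_def)
qed

lemma dice_poly_solutions:
  assumes p: "prime p"
  shows "dice_poly ` {A. is_solution (p ^ k) A} = solution_poly p k ` exponents k"
proof (intro equalityI subsetI)
  fix P assume "P \<in> solution_poly p k ` exponents k"
  then obtain e where e: "e \<in> exponents k" and P: "P = solution_poly p k e" by blast
  define f where "f = (\<lambda>i. 2 - e i)"
  have ef: "e i + f i = 2" if "i < k" for i
    using e that by (auto simp: exponents_def f_def PiE_iff)
  have sum_e: "sum e {..<k} = k" using e by (simp add: exponents_def)
  have "sum e {..<k} + sum f {..<k} = (\<Sum>i<k. 2)"
    unfolding sum.distrib[symmetric] using ef by (intro sum.cong) auto
  with sum_e have sum_f: "sum f {..<k} = k" by simp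
  obtain A where A: "dice_poly A = solution_poly p k e"
    using dice_poly_surj coeff_solution_poly_nonneg by metis
  obtain B where B: "dice_poly B = solution_poly p k f"
    using dice_poly_surj coeff_solution_poly_nonneg by metis
  have "is_dice (p ^ k) A" "is_dice (p ^ k) B"
    unfolding is_dice_iff A B by (simp_all add: poly_solution_poly_1 coeff_solution_poly_0 sum_e sum_f)
  moreover have "standard_sums (p ^ k) A B"
    unfolding standard_sums_iff A B dice_poly_standard_prime_power[OF p] using ef by (rule solution_poly_mult)
  ultimately have "is_solution (p ^ k) A" by (auto simp: is_solution_def)
  thus "P \<in> dice_poly ` {A. is_solution (p ^ k) A}" using A P by (metis imageI mem_Collect_eq)
next
  fix P assume "P \<in> dice_poly ` {A. is_solution (p ^ k) A}"
  then obtain A B where P: "P = dice_poly A" and A: "is_dice (p ^ k) A" and B: "is_dice (p ^ k) B"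
    and AB: "standard_sums (p ^ k) A B" by (auto simp: is_solution_def)
  have p1: "p > 1" using p prime_gt_1_nat by blast
  \<comment> \<open>Positive labels mean no constant term, so each dice carries one factor X;
    together they account for the X^2 of the standard game.\<close>
  have "monom 1 1 dvd dice_poly A" "monom 1 1 dvd dice_poly B"
    using A B by (auto simp: is_dice_iff monom_1_dvd_iff')
  then obtain A' B' where A': "dice_poly A = monom 1 1 * A'" and B': "dice_poly B = monom 1 1 * B'"
    by (auto elim!: dvdE)
  have "monom 1 1 ^ 2 * (A' * B') = monom 1 1 ^ 2 * (\<Prod>i<k. cyclotomic_pp p i ^ 2)"
    using AB unfolding standard_sums_iff dice_poly_standard_prime_power[OF p] A' B'
    by (simp add: solution_poly_def power2_eq_square prod.distrib algebra_simps)
  hence "A' * B' = (\<Prod>i<k. cyclotomic_pp p i ^ 2)" by simp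
  hence dvd: "A' dvd (\<Prod>i<k. cyclotomic_pp p i ^ 2)" by (metis dvd_triv_left)
  define m where "m = (\<lambda>i. multiplicity (cyclotomic_pp p i) A')"
  have inj: "inj_on (cyclotomic_pp p) {..<k}"
    using inj_on_subset[OF inj_cyclotomic_pp[OF p]] by simp
  note fac = dvd_prod_distinct_primes[OF finite_lessThan inj prime_cyclotomic_pp[OF p] dvd]
  have m_le: "m i \<le> 2" if "i < k" for i
    using fac(2)[of i] that by (simp add: m_def)
  have A'0: "A' \<noteq> 0" using A p1 A' by (auto simp: is_dice_iff)
  \<comment> \<open>Unique factorization leaves a sign open. It is positive because the leading
    coefficient of a dice polynomial is a multiplicity.\<close>
  have "lead_coeff A' = lead_coeff (dice_poly A)" unfolding A' by (simp add: lead_coeff_mult degree_monom_eq)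
  also have "\<dots> \<ge> 0" by simp
  finally have "lead_coeff A' > 0" using A'0 by (simp add: order_less_le)
  hence "normalize A' = A'" by (simp add: normalize_poly_eq_map_poly)
  moreover have "normalize (\<Prod>i<k. cyclotomic_pp p i ^ m i) = (\<Prod>i<k. cyclotomic_pp p i ^ m i)"
    by (simp add: normalize_poly_eq_map_poly lead_coeff_prod lead_coeff_power lead_coeff_cyclotomic_pp[OF p])
  ultimately have "A' = (\<Prod>i<k. cyclotomic_pp p i ^ m i)"
    using fac(1) by (simp add: m_def)
  hence eq: "P = solution_poly p k (restrict m {..<k})"
    unfolding P A' solution_poly_def by simp
  \<comment> \<open>Evaluation at 1 turns the dice size into the condition on the exponent
    sum.\<close>
  have "int p ^ sum m {..<k} = int p ^ k"
    using A poly_solution_poly_1[of p k "restrict m {..<k}"] unfolding is_dice_iff P[symmetric] eq by simp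
  hence "sum m {..<k} = k" using p1 by simp
  hence "restrict m {..<k} \<in> exponents k" using m_le by (simp add: exponents_def)
  thus "P \<in> solution_poly p k ` exponents k" using eq by blast
qed

text \<open>The standard dice is itself a solution, with all exponents 1, and is the one left out of
  \<open>S2\<close>.\<close>

lemma S2_prime_power:
  assumes p: "prime p"
  shows "Suc (S2 (p ^ k)) = trinom k 0"
proof -
  let ?S = "{A. is_solution (p ^ k) A}"
  have "card ?S = card (dice_poly ` ?S)"
    by (rule card_image[symmetric]) (auto simp: inj_on_def)
  also have "\<dots> = trinom k 0"
    unfolding dice_poly_solutions[OF p] card_exponents[symmetric]
    by (rule card_image[OF inj_on_solution_poly[OF p]])
  finally have card: "card ?S = trinom k 0" .
  have "dice_poly (standard_dice (p ^ k)) \<in> solution_poly p k ` exponents k"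
    unfolding dice_poly_standard_prime_power[OF p]
    by (rule image_eqI[of _ _ "restrict (\<lambda>_. 1) {..<k}"]) (auto simp: solution_poly_def exponents_def)
  hence std: "standard_dice (p ^ k) \<in> ?S"
    unfolding dice_poly_solutions[OF p, symmetric] by auto
  have "?S = insert (standard_dice (p ^ k)) (nonstandard_solutions (p ^ k))"
    using std by (auto simp: nonstandard_solutions_def)
  moreover have "standard_dice (p ^ k) \<notin> nonstandard_solutions (p ^ k)"
    by (simp add: nonstandard_solutions_def)
  ultimately have "card ?S = Suc (S2 (p ^ k))"
    using finite_nonstandard_solutions by (simp add: S2_def)
  with card show ?thesis by simp
qed

lemma S2_prime_power_bounds:
  assumes p: "prime p" and k: "k \<ge> 4"
  shows "(3 ^ k + (-1) ^ k - 2) / (2 * real k) < real (S2 (p ^ k))"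
    and "real (S2 (p ^ k)) < (3 ^ k + (-1) ^ k - 2) / 4"
proof -
  define T where "T = trinom k 0"
  have T: "real T = real (S2 (p ^ k)) + 1"
    unfolding T_def S2_prime_power[OF p, symmetric] by simp
  have "real_of_int (4 * int T) < real_of_int (3 ^ k + (-1) ^ k + 2)"
    unfolding T_def of_int_less_iff by (rule central_trinom_less[OF k])
  thus "real (S2 (p ^ k)) < (3 ^ k + (-1) ^ k - 2) / 4" using T by simp
  have "real (3 ^ k) \<le> real ((2 * k - 1) * T + 2)"
    unfolding T_def of_nat_le_iff by (rule pow3_le_central_trinom) (use k in simp)
  hence 1: "3 ^ k \<le> (2 * real k - 1) * real T + 2" using k by (simp add: of_nat_diff)
  have "real (4 * k ^ 2 + 1) < real (3 ^ k)"
    unfolding of_nat_less_iff by (rule four_squares_less_pow3[OF k])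
  hence 2: "4 * real k ^ 2 + 1 < 3 ^ k" by simp
  \<comment> \<open>After expansion this is exactly \<open>2\<close>; the next step inserts the
    lower bound on \<open>T\<close>, and the common factor \<open>2 * real k - 1\<close> is
    cancelled at the end.\<close>
  have "(2 * real k - 1) * (3 ^ k - 1) < 2 * real k * (3 ^ k - 2) - 2 * real k * (2 * real k - 1)"
    using 2 by (simp add: algebra_simps power2_eq_square)
  also have "\<dots> \<le> 2 * real k * ((2 * real k - 1) * real T) - 2 * real k * (2 * real k - 1)"
    using 1 by (intro diff_right_mono mult_left_mono) auto
  also have "\<dots> = (2 * real k - 1) * (2 * real k * real (S2 (p ^ k)))"
    unfolding T by (simp add: algebra_simps)
  finally have "3 ^ k - 1 < 2 * real k * real (S2 (p ^ k))"
    using k by (simp add: mult_less_cancel_left_pos)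
  moreover have "(-1) ^ k \<le> (1::real)" by (cases "even k") auto
  ultimately have "3 ^ k + (-1) ^ k - 2 < 2 * real k * real (S2 (p ^ k))" by linarith
  thus "(3 ^ k + (-1) ^ k - 2) / (2 * real k) < real (S2 (p ^ k))"
    using k by (simp add: divide_less_eq mult.commute)
qed

theorem theorem0p0p4:
  shows "(\<forall>(p::nat) (q::nat) (k::nat). prime p \<and> prime q \<and> k \<ge> 1 \<longrightarrow> S2 (p ^ k) = S2 (q ^ k)) \<and>
         (\<forall>(p::nat) (k::nat). prime p \<and> k \<ge> 4 \<longrightarrow>
            (3 ^ k + (-1) ^ k - 2) / (2 * real k) < real (S2 (p ^ k)) \<and>
            real (S2 (p ^ k)) < (3 ^ k + (-1) ^ k - 2) / 4)"
proof (intro conjI allI impI)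
  fix p q k :: nat assume "prime p \<and> prime q \<and> k \<ge> 1"
  \<comment> \<open>Both sides equal \<open>trinom k 0\<close>, which does not involve the
    prime.\<close>
  hence "Suc (S2 (p ^ k)) = Suc (S2 (q ^ k))" by (simp only: S2_prime_power)
  thus "S2 (p ^ k) = S2 (q ^ k)" by simp
qed (use S2_prime_power_bounds in blast)+

end
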